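(* For $y\in[Y_L,Y_{1,\gamma})$ and $i=1,2$, let $E_i^\gamma(y)$ be the expected utility of agent $i$ in the coordination game (see context) when the strategies $(P_{1,\gamma}(y),P_{2,\gamma}(y))$ are played. Then the indifference value of the game for agent one is given by $$e_{1,\gamma}(y):=U^{-1}(E_1^\gamma(y))=-\frac1\gamma\log\big(-a_1^\gamma l(y)-a_2^\gamma f(y)-a_S^\gamma s_1(y)\big),$$ and $e_{2,\gamma}(y):=U^{-1}(E_2^\gamma(y))$ is defined similarly. Assume now $q_S>0$. For $y\in[Y_L,Y_{1,\gamma})$ and $i=1,2$, $$e_{i,\gamma}(y)=E_i(y)=F(y)\qquad\text{for all }\gamma>0,$$ where $E_1(y)=E_2(y):=\frac{1-p_0(y)}{2-p_0(y)}\big(L(y)+F(y)\big)+\frac{p_0(y)}{2-p_0(y)}S(y)$.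
   Context: Constants: $r\in\mathbb{R}$, $\eta>0$, $\delta>0$, $K>0$, $0<D_2<D_1$; $$\beta:=\Big(\tfrac12-\tfrac{r-\delta}{\eta^2}\Big)+\sqrt{\Big(\tfrac12-\tfrac{r-\delta}{\eta^2}\Big)^2+\tfrac{2r}{\eta^2}}>1,\qquad Y_F:=\frac{\delta K\beta}{D_2(\beta-1)}.$$ For $y>0$: $F(y)=\frac{K}{\beta-1}(y/Y_F)^\beta$ if $y\le Y_F$, $F(y)=\frac{D_2y}{\delta}-K$ if $y>Y_F$; $L(y)=\frac{D_1y}{\delta}-\frac{D_1-D_2}{D_2}\frac{K\beta}{\beta-1}(y/Y_F)^\beta-K$ if $y<Y_F$, $L(y)=\frac{D_2y}{\delta}-K$ if $y\ge Y_F$; $S(y)=\frac{D_2y}{\delta}-K$. $Y_L$ is the unique point of $(0,Y_F)$ such that $S<L<F$ for $y<Y_L$, $S<L=F$ at $Y_L$, $S<F<L$ on $(Y_L,Y_F)$; and $S=F=L$ for $y\ge Y_F$. Regulator probabilities $q_1\ge q_2\ge0$, $q_S\ge0$, $q_1+q_2+q_S=1$. Utility $U(x)=-\exp(-\gamma x)$ with $\gamma>0$; $l:=U(L)$, $f:=U(F)$, $s:=U(S)$, $s_1:=q_1l+q_2f+q_Ss$, $s_2:=q_2l+q_1f+q_Ss$. For $y\in[Y_L,Y_F)$: $p_0(y):=\frac{L(y)-F(y)}{L(y)-S(y)}$ and $$P_{i,\gamma}(y):=\frac{l(y)-f(y)}{q_i(l(y)-f(y))+q_S(l(y)-s(y))},\quad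 i=1,2,$$ the latter extended to $y=Y_F$ by its left limit. $Y_{1,\gamma}\in[Y_L,Y_F]$ is the point with $P_{2,\gamma}(Y_{1,\gamma})=1$. Coordination game: in each round agent $i$ exercises with probability $p_i$ independently; (exercise, exercise) ends the game with expected utilities $(s_1,s_2)$, (exercise, defer) with $(l,f)$, (defer, exercise) with $(f,l)$, and (defer, defer) leads to a new identical round. With $(p_1,p_2)=(P_{1,\gamma}(y),P_{2,\gamma}(y))$, the outcome probabilities are $a_1^\gamma=\frac{p_1(1-p_2)}{p_1+p_2-p_1p_2}$, $a_2^\gamma=\frac{p_2(1-p_1)}{p_1+p_2-p_1p_2}$, $a_S^\gamma=\frac{p_1p_2}{p_1+p_2-p_1p_2}$ (at $y=Y_L$, where $p_1=p_2=0$, understood as limits as $y\downarrow Y_L$), so that $E_1^\gamma=a_1^\gamma l+a_2^\gamma f+a_S^\gamma s_1$ and $E_2^\gamma=a_2^\gamma l+a_1^\gamma f+a_S^\gamma s_2$. *)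

theory Defs
  imports Complex_Main
begin

text \<open>Agent-indexed quantities are functions of type \<open>agent\<close>; for agent \<open>i\<close> the opponent is
  \<open>other i\<close>.\<close>

datatype agent = One | Two

fun other :: "agent \<Rightarrow> agent" where
  "other One = Two"
| "other Two = One"

text \<open>The fields are, in order, \<open>r\<close>, \<open>\<eta>\<close>, \<open>\<delta>\<close>, \<open>K\<close>, \<open>D\<^sub>1\<close>, \<open>D\<^sub>2\<close>.\<close>

record market =
  rate :: real
  vol :: real
  yield_rate :: real
  cost :: real
  demand1 :: real
  demand2 :: real

text \<open>\<open>lead_prob Q One\<close>, \<open>lead_prob Q Two\<close> and \<open>sim_prob Q\<close> are \<open>q\<^sub>1\<close>, \<open>q\<^sub>2\<close> and \<open>q\<^sub>S\<close>.\<close>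

record regulator =
  lead_prob :: "agent \<Rightarrow> real"
  sim_prob :: real

definition beta :: "market \<Rightarrow> real" where
  "beta M =
     (1 / 2 - (rate M - yield_rate M) / (vol M)\<^sup>2)
     + sqrt ((1 / 2 - (rate M - yield_rate M) / (vol M)\<^sup>2)\<^sup>2 + 2 * rate M / (vol M)\<^sup>2)"

definition Y_F :: "market \<Rightarrow> real" where
  "Y_F M = yield_rate M * cost M * beta M / (demand2 M * (beta M - 1))"

definition F_val :: "market \<Rightarrow> real \<Rightarrow> real" where
  "F_val M y =
     (if y \<le> Y_F M then cost M / (beta M - 1) * (y / Y_F M) powr beta M
      else demand2 M * y / yield_rate M - cost M)"

definition L_val :: "market \<Rightarrow> real \<Rightarrow> real" where
  "L_val M y =
     (if y < Y_F M then
        demand1 M * y / yield_rate M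
        - (demand1 M - demand2 M) / demand2 M * (cost M * beta M / (beta M - 1))
            * (y / Y_F M) powr beta M
        - cost M
      else demand2 M * y / yield_rate M - cost M)"

definition S_val :: "market \<Rightarrow> real \<Rightarrow> real" where
  "S_val M y = demand2 M * y / yield_rate M - cost M"

definition Y_L :: "market \<Rightarrow> real" where
  "Y_L M = (THE x. 0 < x \<and> x < Y_F M
     \<and> (\<forall>y. 0 < y \<and> y < x \<longrightarrow> S_val M y < L_val M y \<and> L_val M y < F_val M y)
     \<and> S_val M x < L_val M x \<and> L_val M x = F_val M x
     \<and> (\<forall>y. x < y \<and> y < Y_F M \<longrightarrow> S_val M y < F_val M y \<and> F_val M y < L_val M y))"

text \<open>\<open>uL\<close>, \<open>uF\<close>, \<open>uS\<close> are \<open>l\<close>, \<open>f\<close>, \<open>s\<close>; \<open>s_agent\<close> gives \<open>s\<^sub>1\<close> and \<open>s\<^sub>2\<close>.\<close>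

definition utility :: "real \<Rightarrow> real \<Rightarrow> real" where
  "utility \<gamma> x = - exp (- \<gamma> * x)"

definition uL :: "market \<Rightarrow> real \<Rightarrow> real \<Rightarrow> real" where
  "uL M \<gamma> y = utility \<gamma> (L_val M y)"

definition uF :: "market \<Rightarrow> real \<Rightarrow> real \<Rightarrow> real" where
  "uF M \<gamma> y = utility \<gamma> (F_val M y)"

definition uS :: "market \<Rightarrow> real \<Rightarrow> real \<Rightarrow> real" where
  "uS M \<gamma> y = utility \<gamma> (S_val M y)"

definition s_agent :: "market \<Rightarrow> regulator \<Rightarrow> real \<Rightarrow> agent \<Rightarrow> real \<Rightarrow> real" where
  "s_agent M Q \<gamma> i y =
     lead_prob Q i * uL M \<gamma> y + lead_prob Q (other i) * uF M \<gamma> y + sim_prob Q * uS M \<gamma> y"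

definition p0 :: "market \<Rightarrow> real \<Rightarrow> real" where
  "p0 M y = (L_val M y - F_val M y) / (L_val M y - S_val M y)"

definition P_formula :: "market \<Rightarrow> regulator \<Rightarrow> real \<Rightarrow> agent \<Rightarrow> real \<Rightarrow> real" where
  "P_formula M Q \<gamma> i y =
     (uL M \<gamma> y - uF M \<gamma> y)
     / (lead_prob Q i * (uL M \<gamma> y - uF M \<gamma> y) + sim_prob Q * (uL M \<gamma> y - uS M \<gamma> y))"

definition exercise_prob :: "market \<Rightarrow> regulator \<Rightarrow> real \<Rightarrow> agent \<Rightarrow> real \<Rightarrow> real" where
  "exercise_prob M Q \<gamma> i y =
     (if y = Y_F M then Lim (at_left (Y_F M)) (P_formula M Q \<gamma> i) else P_formula M Q \<gamma> i y)"

text \<open>The coordination game. A round is a pair of independent moves, of agent one and of agent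
  two. \<open>end_prob p m\<close> is the probability that the game ends with the moves \<open>m\<close>: for some \<open>n\<close>,
  both agents defer in \<open>n\<close> rounds and play \<open>m\<close> in the next one.\<close>

datatype move = Exercise | Defer

fun move_prob :: "real \<Rightarrow> move \<Rightarrow> real" where
  "move_prob p Exercise = p"
| "move_prob p Defer = 1 - p"

definition round_prob :: "(agent \<Rightarrow> real) \<Rightarrow> move \<times> move \<Rightarrow> real" where
  "round_prob p m = move_prob (p One) (fst m) * move_prob (p Two) (snd m)"

definition end_prob :: "(agent \<Rightarrow> real) \<Rightarrow> move \<times> move \<Rightarrow> real" where
  "end_prob p m = (\<Sum>n. round_prob p (Defer, Defer) ^ n * round_prob p m)"

text \<open>At \<open>Y\<^sub>L\<close> both exercise probabilities vanish and the game never ends; outcome probabilities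
  are taken there as limits from the right.\<close>

definition limit_at_Y_L :: "market \<Rightarrow> (real \<Rightarrow> real) \<Rightarrow> real \<Rightarrow> real" where
  "limit_at_Y_L M g y = (if y = Y_L M then Lim (at_right (Y_L M)) g else g y)"

definition game_prob :: "market \<Rightarrow> regulator \<Rightarrow> real \<Rightarrow> move \<times> move \<Rightarrow> real \<Rightarrow> real" where
  "game_prob M Q \<gamma> m = limit_at_Y_L M (\<lambda>y. end_prob (\<lambda>i. exercise_prob M Q \<gamma> i y) m)"

text \<open>\<open>E_util M Q \<gamma> i y\<close> is the expected utility of agent \<open>i\<close> in the game.\<close>

fun E_util :: "market \<Rightarrow> regulator \<Rightarrow> real \<Rightarrow> agent \<Rightarrow> real \<Rightarrow> real" where
  "E_util M Q \<gamma> One y =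
     game_prob M Q \<gamma> (Exercise, Defer) y * uL M \<gamma> y
     + game_prob M Q \<gamma> (Defer, Exercise) y * uF M \<gamma> y
     + game_prob M Q \<gamma> (Exercise, Exercise) y * s_agent M Q \<gamma> One y"
| "E_util M Q \<gamma> Two y =
     game_prob M Q \<gamma> (Exercise, Defer) y * uF M \<gamma> y
     + game_prob M Q \<gamma> (Defer, Exercise) y * uL M \<gamma> y
     + game_prob M Q \<gamma> (Exercise, Exercise) y * s_agent M Q \<gamma> Two y"

definition indiff_value :: "market \<Rightarrow> regulator \<Rightarrow> real \<Rightarrow> agent \<Rightarrow> real \<Rightarrow> real" where
  "indiff_value M Q \<gamma> i y = inv (utility \<gamma>) (E_util M Q \<gamma> i y)"

text \<open>\<open>a_lead\<close> gives \<open>a\<^sub>1\<close> and \<open>a\<^sub>2\<close>; \<open>a_sim\<close> is \<open>a\<^sub>S\<close>.\<close>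

definition a_lead :: "market \<Rightarrow> regulator \<Rightarrow> real \<Rightarrow> agent \<Rightarrow> real \<Rightarrow> real" where
  "a_lead M Q \<gamma> i = limit_at_Y_L M (\<lambda>y.
     let p = exercise_prob M Q \<gamma> i y; p' = exercise_prob M Q \<gamma> (other i) y
     in p * (1 - p') / (p + p' - p * p'))"

definition a_sim :: "market \<Rightarrow> regulator \<Rightarrow> real \<Rightarrow> real \<Rightarrow> real" where
  "a_sim M Q \<gamma> = limit_at_Y_L M (\<lambda>y.
     let p1 = exercise_prob M Q \<gamma> One y; p2 = exercise_prob M Q \<gamma> Two y
     in p1 * p2 / (p1 + p2 - p1 * p2))"

text \<open>The value \<open>E\<^sub>1 = E\<^sub>2\<close> is the same for both agents.\<close>

definition E_val :: "market \<Rightarrow> real \<Rightarrow> real" where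
  "E_val M y =
     (1 - p0 M y) / (2 - p0 M y) * (L_val M y + F_val M y) + p0 M y / (2 - p0 M y) * S_val M y"

end

theory Submission imports Defs begin

text \<open>With \<open>N = l - f\<close> and \<open>d\<^sub>i = q\<^sub>i * N + q\<^sub>S * (l - s)\<close> the exercise probabilities are
  \<open>p\<^sub>i = N / d\<^sub>i\<close>. Whenever \<open>Y\<^sub>L < y < Y\<^sub>F\<close> and \<open>q\<^sub>S > 0\<close>, the probability weight
  \<open>(1 - p\<^sub>1) * (1 - p\<^sub>2)\<close> of a further round has absolute value below one, even if some \<open>p\<^sub>i\<close>
  exceeds one, so that no monotonicity of the \<open>p\<^sub>i\<close> in \<open>y\<close> is needed. Cancelling \<open>N\<close> gives
  \<open>a\<^sub>1 = (d\<^sub>2 - N) / (d\<^sub>1 + d\<^sub>2 - N)\<close> and \<open>a\<^sub>S = N / (d\<^sub>1 + d\<^sub>2 - N)\<close>, which are continuous at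
  \<open>Y\<^sub>L\<close>. Since \<open>s\<^sub>1 - f = N - d\<^sub>2\<close>, the expected utility is \<open>f\<close>.\<close>

section \<open>Affine functions minus a power\<close>

lemma deriv_affine_minus_powr:
  fixes x :: real
  assumes "0 < x"
  shows "((\<lambda>x. a * x - b * x powr p - c) has_real_derivative a - b * p * x powr (p - 1)) (at x)"
  using assms by (auto intro!: derivative_eq_intros)

lemma continuous_on_affine_minus_powr:
  fixes p :: real
  assumes "0 < p"
  shows "continuous_on {0..} (\<lambda>x. a * x - b * x powr p - c)"
  using assms by (auto intro!: continuous_intros continuous_on_powr')

text \<open>The function \<open>g\<close> is strictly concave with \<open>g 0 = - c\<close> and
  \<open>g 1 = 0\<close>. The slope condition makes it decreasing at 1, so it rises to an interior
  maximum and then falls to 0. Its only zero below 1 lies on the rising branch.\<close>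

lemma affine_minus_powr_crossing:
  fixes a b c p :: real
  assumes p: "1 < p" and b: "0 < b" and c: "0 < c" and abc: "a = b + c" and slope: "a < b * p"
  defines "g \<equiv> \<lambda>x. a * x - b * x powr p - c"
  obtains x where "0 < x" "x < 1" "g x = 0"
    "\<And>t. 0 < t \<Longrightarrow> t < x \<Longrightarrow> g t < 0" "\<And>t. x < t \<Longrightarrow> t < 1 \<Longrightarrow> 0 < g t"
proof -
  \<comment> \<open>The critical point of \<open>g\<close>, solving
    \<open>a = b * p * z powr (p - 1)\<close>.\<close>
  define z where "z = (a / (b * p)) powr (1 / (p - 1))"
  have a: "0 < a" and bp: "0 < b * p"
    using assms by auto
  have ratio: "0 < a / (b * p)" "a / (b * p) < 1"
    using a bp slope by (auto simp: divide_simps)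
  have z0: "0 < z"
    using a b p by (simp add: z_def)
  have "(a / (b * p)) powr (1 / (p - 1)) < 1 powr (1 / (p - 1))"
    using ratio p by (intro powr_less_mono2) auto
  then have z1: "z < 1"
    by (simp add: z_def)
  have zp: "z powr (p - 1) = a / (b * p)"
    using p a bp by (simp add: z_def powr_powr)
  have g1: "g 1 = 0"
    by (simp add: g_def abc)
  have cont: "continuous_on {u..v} g" if "0 \<le> u" for u v
    unfolding g_def
    using continuous_on_subset[OF continuous_on_affine_minus_powr[of p a b c]] that p by auto
  have inc: "g u < g v" if "0 \<le> u" "u < v" "v \<le> z" for u v
  proof (rule DERIV_pos_imp_increasing_open[OF \<open>u < v\<close>])
    fix t assume t: "u < t" "t < v"
    then have "t powr (p - 1) < z powr (p - 1)"
      using that p by (intro powr_less_mono2) auto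
    then have "0 < a - b * p * t powr (p - 1)"
      using bp by (simp add: zp field_simps)
    then show "\<exists>d. (g has_real_derivative d) (at t) \<and> 0 < d"
      using deriv_affine_minus_powr[of t a b p c] t that unfolding g_def by auto
  qed (use that cont in auto)
  have dec: "g v < g u" if "z \<le> u" "u < v" for u v
  proof (rule DERIV_neg_imp_decreasing_open[OF \<open>u < v\<close>])
    fix t assume t: "u < t" "t < v"
    then have "z powr (p - 1) < t powr (p - 1)"
      using that p z0 by (intro powr_less_mono2) auto
    then have "a - b * p * t powr (p - 1) < 0"
      using bp by (simp add: zp field_simps)
    then show "\<exists>d. (g has_real_derivative d) (at t) \<and> d < 0"
      using deriv_affine_minus_powr[of t a b p c] t that z0 unfolding g_def by auto
  qed (use that z0 cont in auto)
  have gz: "0 < g z"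
    using dec[of z 1] z1 g1 by simp
  have g0: "g 0 < 0"
    using c by (simp add: g_def)
  obtain x where x: "0 \<le> x" "x \<le> z" "g x = 0"
    using IVT'[of g 0 0 z] g0 gz z0 cont by force
  have xz: "0 < x" "x < z"
    using x gz g0 by (auto simp: less_le)
  show thesis
  proof
    fix t assume "x < t" "t < 1"
    then show "0 < g t"
      using inc[of x t] dec[of t 1] g1 x by (cases "t \<le> z") auto
  next
    fix t assume "0 < t" "t < x"
    then show "g t < 0"
      using inc[of t x] x by auto
  qed (use x xz z1 in auto)
qed

text \<open>The left side is the tangent at 1 of the strictly convex function
  \<open>x powr p\<close>.\<close>

lemma bernoulli_powr_less:
  fixes p x :: real
  assumes p: "1 < p" and x: "0 < x" "x < 1"
  shows "p * x - (p - 1) < x powr p"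
proof -
  let ?g = "\<lambda>x. p * x - 1 * x powr p - (p - 1)"
  have "?g x < ?g 1"
  proof (rule DERIV_pos_imp_increasing_open[OF x(2)])
    fix t assume t: "x < t" "t < 1"
    then have "t powr (p - 1) < 1 powr (p - 1)"
      using x p by (intro powr_less_mono2) auto
    then have "0 < p - 1 * p * t powr (p - 1)"
      using p by simp
    then show "\<exists>d. (?g has_real_derivative d) (at t) \<and> 0 < d"
      using deriv_affine_minus_powr[of t p 1 p "p - 1"] t x by auto
  qed (use continuous_on_subset[OF continuous_on_affine_minus_powr[of p p 1 "p - 1"]] x p in auto)
  then show ?thesis
    by simp
qed

section \<open>Leader and follower values and the preemption point \<open>Y_L\<close>\<close>

locale preemption =
  fixes M :: market
  assumes vol_pos: "0 < vol M" and yield_pos: "0 < yield_rate M" and cost_pos: "0 < cost M"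
    and demand2_pos: "0 < demand2 M" and demand_less: "demand2 M < demand1 M"
begin

text \<open>\<open>beta M\<close> is the larger root of a monic quadratic whose value at \<open>1\<close> is
  \<open>- 2 * yield_rate M / (vol M)\<^sup>2\<close>.\<close>

lemma beta_gt_1: "1 < beta M"
proof -
  define a where "a = 1 / 2 - (rate M - yield_rate M) / (vol M)\<^sup>2"
  define c where "c = 2 * rate M / (vol M)\<^sup>2"
  have "a\<^sup>2 + c - (1 - a)\<^sup>2 = 2 * yield_rate M / (vol M)\<^sup>2"
    using vol_pos by (simp add: a_def c_def power2_eq_square field_simps)
  also have "\<dots> > 0"
    using vol_pos yield_pos by simp
  finally have "(1 - a)\<^sup>2 < a\<^sup>2 + c"
    by simp
  then have "\<bar>1 - a\<bar> < sqrt (a\<^sup>2 + c)"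
    by (metis real_sqrt_abs real_sqrt_less_mono)
  then show ?thesis
    unfolding beta_def a_def[symmetric] c_def[symmetric] by simp
qed

lemma Y_F_pos: "0 < Y_F M"
  using beta_gt_1 yield_pos cost_pos demand2_pos by (simp add: Y_F_def)

text \<open>In the variable \<open>x = y / Y_F M\<close>, below \<open>Y_F M\<close>, all three
  values are \<open>scale\<close> times a function of \<open>x\<close> with only
  \<open>beta M\<close> and \<open>ratio\<close> as parameters.\<close>

definition scale :: real where
  "scale = cost M / (beta M - 1)"

definition ratio :: real where
  "ratio = demand1 M / demand2 M"

lemma scale_pos: "0 < scale"
  using beta_gt_1 cost_pos by (simp add: scale_def)

lemma ratio_gt_1: "1 < ratio"
  using demand2_pos demand_less by (simp add: ratio_def)

lemma F_val_scaled:
  "y < Y_F M \<Longrightarrow> F_val M y = scale * (y / Y_F M) powr beta M"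
  by (simp add: F_val_def scale_def)

lemma linear_scaled: "D * y / yield_rate M = scale * (D / demand2 M * beta M * (y / Y_F M))"
  using beta_gt_1 yield_pos cost_pos demand2_pos
  by (simp add: Y_F_def scale_def field_simps)

lemma cost_scaled: "cost M = scale * (beta M - 1)"
  using beta_gt_1 by (simp add: scale_def)

lemma S_val_scaled: "S_val M y = scale * (beta M * (y / Y_F M) - (beta M - 1))"
  using demand2_pos linear_scaled[of "demand2 M" y]
  by (simp add: S_val_def cost_scaled right_diff_distrib)

lemma L_val_scaled:
  assumes "y < Y_F M"
  shows "L_val M y = scale * (ratio * beta M * (y / Y_F M)
           - (ratio - 1) * beta M * (y / Y_F M) powr beta M - (beta M - 1))"
proof -
  have "(demand1 M - demand2 M) / demand2 M = ratio - 1"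
    using demand2_pos by (simp add: ratio_def field_simps)
  moreover have "cost M * beta M / (beta M - 1) = scale * beta M"
    by (simp add: scale_def)
  ultimately show ?thesis
    using assms linear_scaled[of "demand1 M" y]
    by (simp add: L_val_def ratio_def[symmetric] right_diff_distrib)
      (simp add: cost_scaled right_diff_distrib)
qed

lemma L_minus_F_scaled:
  assumes "y < Y_F M"
  shows "L_val M y - F_val M y = scale * (ratio * beta M * (y / Y_F M)
           - ((ratio - 1) * beta M + 1) * (y / Y_F M) powr beta M - (beta M - 1))"
  using assms by (simp add: L_val_scaled F_val_scaled algebra_simps)

text \<open>Smooth pasting: \<open>S_val M\<close> is the tangent at \<open>Y_F M\<close> of the
  convex branch of \<open>F_val M\<close>.\<close>

lemma S_less_F:
  assumes "0 < y" "y < Y_F M"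
  shows "S_val M y < F_val M y"
  using assms bernoulli_powr_less[of "beta M" "y / Y_F M"] beta_gt_1 scale_pos Y_F_pos
  by (simp add: S_val_scaled F_val_scaled)

lemma S_less_L:
  assumes "0 < y" "y < Y_F M"
  shows "S_val M y < L_val M y"
proof -
  let ?x = "y / Y_F M"
  have x: "0 < ?x" "?x < 1"
    using assms by auto
  then have "?x powr beta M < ?x powr 1"
    using beta_gt_1 by (intro powr_less_mono') auto
  then have "0 < scale * ((ratio - 1) * beta M * (?x - ?x powr beta M))"
    using x scale_pos ratio_gt_1 beta_gt_1 by simp
  also have "\<dots> = L_val M y - S_val M y"
    by (simp only: S_val_scaled L_val_scaled[OF assms(2)]) (simp add: algebra_simps)
  finally show ?thesis
    by simp
qed

text \<open>Up to \<open>scale\<close>, the difference of \<open>L_val M\<close> and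
  \<open>F_val M\<close> is an affine function minus a power of \<open>x = y / Y_F M\<close>. Its
  zero in (0,1), multiplied by \<open>Y_F M\<close>, is the point sought.\<close>

lemma Y_L_exists:
  "\<exists>x. 0 < x \<and> x < Y_F M
     \<and> (\<forall>y. 0 < y \<and> y < x \<longrightarrow> S_val M y < L_val M y \<and> L_val M y < F_val M y)
     \<and> S_val M x < L_val M x \<and> L_val M x = F_val M x
     \<and> (\<forall>y. x < y \<and> y < Y_F M \<longrightarrow> S_val M y < F_val M y \<and> F_val M y < L_val M y)"
proof -
  define g where "g = (\<lambda>x. ratio * beta M * x - ((ratio - 1) * beta M + 1) * x powr beta M
    - (beta M - 1))"
  \<comment> \<open>This product is the gap in the slope condition of
    \<open>affine_minus_powr_crossing\<close>.\<close>
  have "0 < (ratio - 1) * (beta M - 1) * beta M"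
    using ratio_gt_1 beta_gt_1 by simp
  then have "ratio * beta M < ((ratio - 1) * beta M + 1) * beta M"
    by (simp add: algebra_simps)
  moreover have "0 < (ratio - 1) * beta M + 1"
    using ratio_gt_1 beta_gt_1 by (simp add: add_pos_pos)
  ultimately obtain x where x: "0 < x" "x < 1" "g x = 0"
    "\<And>t. 0 < t \<Longrightarrow> t < x \<Longrightarrow> g t < 0" "\<And>t. x < t \<Longrightarrow> t < 1 \<Longrightarrow> 0 < g t"
    using beta_gt_1
      affine_minus_powr_crossing[of "beta M" "(ratio - 1) * beta M + 1" "beta M - 1" "ratio * beta M"]
    unfolding g_def by (auto simp: algebra_simps)
  have LF: "L_val M y - F_val M y = scale * g (y / Y_F M)" if "y < Y_F M" for y
    using that by (simp add: L_minus_F_scaled g_def)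
  define w where "w = x * Y_F M"
  have w: "0 < w" "w < Y_F M" "w / Y_F M = x"
    using x Y_F_pos by (auto simp: w_def)
  have below: "L_val M y < F_val M y" if "0 < y" "y < w" for y
  proof -
    have "scale * g (y / Y_F M) < 0"
      using that x(4)[of "y / Y_F M"] Y_F_pos scale_pos
      by (simp add: w_def mult_pos_neg pos_divide_less_eq)
    then show ?thesis
      using LF[of y] that w by simp
  qed
  have above: "F_val M y < L_val M y" if "w < y" "y < Y_F M" for y
  proof -
    have "0 < scale * g (y / Y_F M)"
      using that x(5)[of "y / Y_F M"] Y_F_pos scale_pos
      by (simp add: w_def pos_less_divide_eq)
    then show ?thesis
      using LF[of y] that w by simp
  qed
  have "L_val M w = F_val M w"
    using LF[of w] w x by simp
  then show ?thesis
    using w below above S_less_F S_less_L by (intro exI[of _ w]) auto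
qed

lemma Y_L_ex1:
  "\<exists>!x. 0 < x \<and> x < Y_F M
     \<and> (\<forall>y. 0 < y \<and> y < x \<longrightarrow> S_val M y < L_val M y \<and> L_val M y < F_val M y)
     \<and> S_val M x < L_val M x \<and> L_val M x = F_val M x
     \<and> (\<forall>y. x < y \<and> y < Y_F M \<longrightarrow> S_val M y < F_val M y \<and> F_val M y < L_val M y)" (is "\<exists>!x. ?P x")
proof (rule ex_ex1I)
  show "\<exists>x. ?P x"
    by (rule Y_L_exists)
next
  \<comment> \<open>If \<open>x < z\<close>, the property of \<open>x\<close> gives F < L at
    \<open>z\<close>, whereas that of \<open>z\<close> gives equality there.\<close>
  have not_less: "\<not> x < z" if "?P x" "?P z" for x z
    using that by force
  show "x = z" if "?P x" "?P z" for x z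
    using not_less[OF that] not_less[OF that(2,1)] by simp
qed

lemma Y_L_props:
  "0 < Y_L M \<and> Y_L M < Y_F M
     \<and> (\<forall>y. 0 < y \<and> y < Y_L M \<longrightarrow> S_val M y < L_val M y \<and> L_val M y < F_val M y)
     \<and> S_val M (Y_L M) < L_val M (Y_L M) \<and> L_val M (Y_L M) = F_val M (Y_L M)
     \<and> (\<forall>y. Y_L M < y \<and> y < Y_F M \<longrightarrow> S_val M y < F_val M y \<and> F_val M y < L_val M y)"
  unfolding Y_L_def by (rule theI'[OF Y_L_ex1])

lemma Y_L_pos: "0 < Y_L M" and Y_L_less_Y_F: "Y_L M < Y_F M"
  and L_eq_F_at_Y_L: "L_val M (Y_L M) = F_val M (Y_L M)"
  and F_less_L: "Y_L M < y \<Longrightarrow> y < Y_F M \<Longrightarrow> F_val M y < L_val M y"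
  using Y_L_props by auto

lemma F_le_L: "Y_L M \<le> y \<Longrightarrow> y < Y_F M \<Longrightarrow> F_val M y \<le> L_val M y"
  using L_eq_F_at_Y_L F_less_L by (cases "y = Y_L M") (auto simp: less_le)

lemma E_val_eq_F_val:
  assumes "Y_L M \<le> y" "y < Y_F M"
  shows "E_val M y = F_val M y"
proof -
  have less: "S_val M y < L_val M y" "S_val M y < F_val M y"
    using S_less_L S_less_F assms Y_L_pos by auto
  \<comment> \<open>\<open>T\<close> is the denominator of \<open>p0\<close>, and \<open>R\<close>
    is \<open>T * (2 - p0 M y)\<close>. Once \<open>T\<close> is cleared, the numerator of
    \<open>E_val M y\<close> factors as \<open>F_val M y * R\<close>.\<close>
  define T R where "T = L_val M y - S_val M y" and "R = L_val M y + F_val M y - 2 * S_val M y"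
  have T: "0 < T" and R: "0 < R"
    using less by (auto simp: T_def R_def)
  have p0: "1 - p0 M y = (F_val M y - S_val M y) / T" "2 - p0 M y = R / T"
    using T unfolding p0_def T_def[symmetric] by (simp_all add: R_def T_def field_simps)
  have "E_val M y = (F_val M y - S_val M y) / R * (L_val M y + F_val M y)
      + (L_val M y - F_val M y) / R * S_val M y"
    using T R unfolding E_val_def p0 by (simp add: p0_def T_def)
  also have "\<dots> = F_val M y * R / R"
    unfolding add_divide_distrib[symmetric] times_divide_eq_left
    by (simp add: R_def algebra_simps)
  finally show ?thesis
    using R by simp
qed

section \<open>Continuity below \<open>Y_F\<close> and limits at \<open>Y_L\<close>\<close>

lemma continuous_on_F_val: "continuous_on {0<..<Y_F M} (F_val M)"
proof -
  have "continuous_on {0<..<Y_F M} (\<lambda>y. scale * (y / Y_F M) powr beta M)"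
    using Y_F_pos by (auto intro!: continuous_intros)
  then show ?thesis
    by (rule continuous_on_cong[THEN iffD1, rotated -1]) (simp_all add: F_val_scaled)
qed

lemma continuous_on_L_val: "continuous_on {0<..<Y_F M} (L_val M)"
proof -
  have "continuous_on {0<..<Y_F M} (\<lambda>y. scale * (ratio * beta M * (y / Y_F M)
           - (ratio - 1) * beta M * (y / Y_F M) powr beta M - (beta M - 1)))"
    using Y_F_pos by (auto intro!: continuous_intros)
  then show ?thesis
    by (rule continuous_on_cong[THEN iffD1, rotated -1]) (simp_all add: L_val_scaled)
qed

lemma continuous_on_S_val: "continuous_on A (S_val M)"
  unfolding S_val_def using yield_pos by (auto intro!: continuous_intros)

text \<open>Serves to evaluate game quantities whose formula is 0/0 at \<open>Y_L M\<close>: the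
  identity is checked strictly to the right, and continuity of the closed form \<open>h\<close>
  supplies the limit.\<close>

lemma limit_at_Y_L_eq:
  assumes eq: "\<And>z. Y_L M < z \<Longrightarrow> z < Y_F M \<Longrightarrow> g z = h z"
    and cont: "continuous_on {Y_L M..<Y_F M} h"
    and y: "Y_L M \<le> y" "y < Y_F M"
  shows "limit_at_Y_L M g y = h y"
proof (cases "y = Y_L M")
  case True
  have "(h \<longlongrightarrow> h (Y_L M)) (at (Y_L M) within {Y_L M..<Y_F M})"
    using cont y True by (auto simp: continuous_on_def)
  moreover have "at (Y_L M) within {Y_L M..<Y_F M} = at_right (Y_L M)"
    using y True by (intro at_within_nhd[of _ "{..<Y_F M}"]) auto
  ultimately have "(h \<longlongrightarrow> h (Y_L M)) (at_right (Y_L M))"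
    by simp
  moreover have "eventually (\<lambda>z. h z = g z) (at_right (Y_L M))"
    using eq y True by (auto simp: eventually_at_right intro: exI[of _ "Y_F M"])
  ultimately have "(g \<longlongrightarrow> h (Y_L M)) (at_right (Y_L M))"
    by (rule Lim_transform_eventually)
  then show ?thesis
    using True by (simp add: limit_at_Y_L_def tendsto_Lim)
qed (use eq y in \<open>auto simp: limit_at_Y_L_def\<close>)

end

section \<open>Inverse utility and the geometric series of the game\<close>

lemma utility_inverse: "\<gamma> \<noteq> 0 \<Longrightarrow> x < 0 \<Longrightarrow> utility \<gamma> (- (1 / \<gamma>) * ln (- x)) = x"
  by (simp add: utility_def)

lemma inj_utility: "\<gamma> \<noteq> 0 \<Longrightarrow> inj (utility \<gamma>)"
  by (auto simp: inj_def utility_def)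

text \<open>The range of \<open>utility \<gamma>\<close> is the negative reals, so
  \<open>inv\<close> is determined only for \<open>x < 0\<close>.\<close>

lemma inv_utility: "\<gamma> \<noteq> 0 \<Longrightarrow> x < 0 \<Longrightarrow> inv (utility \<gamma>) x = - (1 / \<gamma>) * ln (- x)"
  using inv_f_f[OF inj_utility, of \<gamma> "- (1 / \<gamma>) * ln (- x)"] utility_inverse[of \<gamma> x] by simp

text \<open>A geometric series in the probability weight of a further round. Only this product is
  bounded, so single \<open>p i\<close> may lie outside [0,1].\<close>

lemma end_prob_eq:
  assumes "\<bar>(1 - p One) * (1 - p Two)\<bar> < 1"
  shows "end_prob p m = round_prob p m / (p One + p Two - p One * p Two)"
proof -
  have "round_prob p (Defer, Defer) = (1 - p One) * (1 - p Two)"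
    by (simp add: round_prob_def)
  then have "(\<lambda>n. round_prob p (Defer, Defer) ^ n * round_prob p m) sums
      (1 / (1 - (1 - p One) * (1 - p Two)) * round_prob p m)"
    using sums_mult2[OF geometric_sums[of "(1 - p One) * (1 - p Two)"]] assms by simp
  then show ?thesis
    unfolding end_prob_def by (simp add: sums_unique[symmetric] algebra_simps)
qed

section \<open>Exercise probabilities and convergence of the repeated game\<close>

locale coordination_game = preemption +
  fixes Q :: regulator and \<gamma> :: real
  assumes q_nonneg: "0 \<le> lead_prob Q i" and q_S_pos: "0 < sim_prob Q"
    and q_sum: "lead_prob Q One + lead_prob Q Two + sim_prob Q = 1"
    and \<gamma>_pos: "0 < \<gamma>"
begin

definition gain :: "real \<Rightarrow> real" where
  "gain y = uL M \<gamma> y - uF M \<gamma> y"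

text \<open>Since the regulator's probabilities sum to one, \<open>loss (other i) y\<close> equals l
  - s_i: what agent \<open>i\<close> loses, relative to leading, when both exercise. It is also the
  denominator of \<open>P_formula\<close> for the agent \<open>other i\<close>.\<close>

definition loss :: "agent \<Rightarrow> real \<Rightarrow> real" where
  "loss i y = lead_prob Q i * gain y + sim_prob Q * (uL M \<gamma> y - uS M \<gamma> y)"

text \<open>The common normalisation: \<open>loss Two y - gain y\<close>,
  \<open>loss One y - gain y\<close> and \<open>gain y\<close> add up to it.\<close>

definition total :: "real \<Rightarrow> real" where
  "total y = loss One y + loss Two y - gain y"

lemma total_other: "total y = loss i y + loss (other i) y - gain y"
  by (cases i) (simp_all add: total_def)

context
  fixes y :: real
  assumes y: "Y_L M \<le> y" "y < Y_F M"
begin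

lemma gain_nonneg: "0 \<le> gain y"
  using F_le_L[OF y] \<gamma>_pos by (simp add: gain_def uL_def uF_def utility_def)

lemma gain_less: "gain y < uL M \<gamma> y - uS M \<gamma> y"
  using S_less_F[of y] Y_L_pos y \<gamma>_pos by (simp add: gain_def uF_def uS_def utility_def)

lemma loss_pos: "0 < loss i y"
  using gain_nonneg gain_less q_S_pos q_nonneg[of i]
  by (auto simp: loss_def intro!: add_nonneg_pos)

text \<open>Eliminating q_1 + q_2 leaves a form whose positivity is immediate from
  \<open>gain_less\<close>.\<close>

lemma total_eq:
  "total y = sim_prob Q * (2 * (uL M \<gamma> y - uS M \<gamma> y) - gain y)"
proof -
  have "(lead_prob Q One + lead_prob Q Two + sim_prob Q) * gain y = gain y"
    by (simp add: q_sum)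
  then show ?thesis
    by (simp add: total_def loss_def algebra_simps)
qed

lemma total_pos: "0 < total y"
  using gain_nonneg gain_less q_S_pos by (simp add: total_eq)

lemma exercise_prob_eq: "exercise_prob M Q \<gamma> i y = gain y / loss i y"
  using y by (simp add: exercise_prob_def P_formula_def gain_def loss_def)

text \<open>After multiplication by \<open>A * B\<close> the claim is a two-sided bound on
  \<open>(A - N) * (B - N)\<close>. The upper bound is positivity of \<open>total y\<close>.\<close>

lemma defer_prob_less_1:
  "\<bar>(1 - gain y / loss One y) * (1 - gain y / loss Two y)\<bar> < 1" if "0 < gain y"
proof -
  define N A B where "N = gain y" and "A = loss One y" and "B = loss Two y"
  define q1 q2 qs T where "q1 = lead_prob Q One" and "q2 = lead_prob Q Two" and "qs = sim_prob Q"
    and "T = uL M \<gamma> y - uS M \<gamma> y"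
  note defs = N_def A_def B_def q1_def q2_def qs_def T_def
  have pos: "0 < A" "0 < B" "0 < N" "N < T" "0 < qs" "0 \<le> q1" "0 \<le> q2"
    using loss_pos that gain_less q_S_pos q_nonneg by (auto simp: defs)
  have A: "A = q1 * N + qs * T" and B: "B = q2 * N + qs * T" and q1: "q1 = 1 - q2 - qs"
    using q_sum by (simp_all add: defs loss_def)
  have "(A - N) * (B - N) + N * (A + B - N) = A * B"
    by (simp add: algebra_simps)
  moreover have "0 < A + B - N"
    using total_pos by (simp add: defs total_def)
  then have "0 < N * (A + B - N)"
    using pos by simp
  \<comment> \<open>The lower bound: eliminating \<open>q1\<close> from part of the expansion
    exhibits the sum as nonnegative terms, two of them positive.\<close>
  moreover have "A * B + (A - N) * (B - N)
      = 2 * q1 * q2 * (N * N) + qs * (N * N) + 2 * (qs * T) * (qs * (T - N))"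
    unfolding A B q1 by (simp add: algebra_simps)
  moreover have "0 < 2 * q1 * q2 * (N * N) + qs * (N * N) + 2 * (qs * T) * (qs * (T - N))"
    using pos by (intro add_pos_pos add_nonneg_pos mult_pos_pos mult_nonneg_nonneg) auto
  ultimately have "\<bar>(A - N) * (B - N)\<bar> < A * B"
    by (simp add: abs_less_iff)
  moreover have "(1 - N / A) * (1 - N / B) = (A - N) * (B - N) / (A * B)"
    using pos by (simp add: field_simps)
  ultimately show ?thesis
    using pos unfolding defs[symmetric] by (simp add: abs_mult)
qed

end

section \<open>Outcome probabilities in closed form\<close>

lemma gain_pos: "Y_L M < y \<Longrightarrow> y < Y_F M \<Longrightarrow> 0 < gain y"
  using F_less_L[of y] \<gamma>_pos by (simp add: gain_def uL_def uF_def utility_def)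

lemma continuous_on_uL: "continuous_on {Y_L M..<Y_F M} (uL M \<gamma>)"
  and continuous_on_uF: "continuous_on {Y_L M..<Y_F M} (uF M \<gamma>)"
  and continuous_on_uS: "continuous_on {Y_L M..<Y_F M} (uS M \<gamma>)"
  unfolding uL_def uF_def uS_def utility_def
  using Y_L_pos continuous_on_S_val
  by (auto intro!: continuous_intros continuous_on_subset[OF continuous_on_L_val]
      continuous_on_subset[OF continuous_on_F_val])

lemma continuous_on_gain: "continuous_on {Y_L M..<Y_F M} gain"
  unfolding gain_def by (intro continuous_intros continuous_on_uL continuous_on_uF)

lemma continuous_on_loss: "continuous_on {Y_L M..<Y_F M} (loss i)"
  unfolding loss_def
  by (intro continuous_intros continuous_on_uL continuous_on_uS continuous_on_gain)

lemma continuous_on_total: "continuous_on {Y_L M..<Y_F M} total"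
  unfolding total_def by (intro continuous_intros continuous_on_loss continuous_on_gain)

lemma continuous_on_lead_outcome:
  "continuous_on {Y_L M..<Y_F M} (\<lambda>z. (loss i z - gain z) / total z)"
  using total_pos
  by (intro continuous_intros continuous_on_loss continuous_on_gain continuous_on_total) force

lemma continuous_on_sim_outcome: "continuous_on {Y_L M..<Y_F M} (\<lambda>z. gain z / total z)"
  using total_pos by (intro continuous_intros continuous_on_gain continuous_on_total) force

text \<open>Cancelling the factor \<open>gain\<close>, which vanishes at \<open>Y_L M\<close>, makes the outcome
  probabilities continuous there.\<close>

lemma lead_outcome_cancel:
  assumes "Y_L M < y" "y < Y_F M"
  shows "gain y / loss i y * (1 - gain y / loss (other i) y)
      / (gain y / loss i y + gain y / loss (other i) y
         - gain y / loss i y * (gain y / loss (other i) y))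
    = (loss (other i) y - gain y) / total y"
proof -
  define N A B where "N = gain y" and "A = loss i y" and "B = loss (other i) y"
  have pos: "0 < N" "0 < A" "0 < B"
    using gain_pos[of y] loss_pos[of y] assms by (auto simp: N_def A_def B_def)
  have T: "total y = A + B - N"
    using total_other[of y i] by (simp add: N_def A_def B_def)
  have "N / A * (1 - N / B) = N / (A * B) * (B - N)"
    and "N / A + N / B - N / A * (N / B) = N / (A * B) * (A + B - N)"
    using pos by (simp_all add: field_simps)
  then show ?thesis
    using pos unfolding T N_def[symmetric] A_def[symmetric] B_def[symmetric] by simp
qed

lemma sim_outcome_cancel:
  assumes "Y_L M < y" "y < Y_F M"
  shows "gain y / loss One y * (gain y / loss Two y)
      / (gain y / loss One y + gain y / loss Two y - gain y / loss One y * (gain y / loss Two y))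
    = gain y / total y"
proof -
  define N A B where "N = gain y" and "A = loss One y" and "B = loss Two y"
  have pos: "0 < N" "0 < A" "0 < B"
    using gain_pos[of y] loss_pos[of y] assms by (auto simp: N_def A_def B_def)
  have T: "total y = A + B - N"
    by (simp add: N_def A_def B_def total_def)
  have "N / A * (N / B) = N / (A * B) * N"
    and "N / A + N / B - N / A * (N / B) = N / (A * B) * (A + B - N)"
    using pos by (simp_all add: field_simps)
  then show ?thesis
    using pos unfolding T N_def[symmetric] A_def[symmetric] B_def[symmetric] by simp
qed

section \<open>Expected utility and indifference value\<close>

context
  fixes y :: real
  assumes y: "Y_L M \<le> y" "y < Y_F M"
begin

lemma a_lead_eq: "a_lead M Q \<gamma> i y = (loss (other i) y - gain y) / total y"
  unfolding a_lead_def
  using lead_outcome_cancel continuous_on_lead_outcome y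
  by (intro limit_at_Y_L_eq) (simp_all add: Let_def exercise_prob_eq)

lemma a_sim_eq: "a_sim M Q \<gamma> y = gain y / total y"
  unfolding a_sim_def
  by (intro limit_at_Y_L_eq continuous_on_sim_outcome y)
    (simp only: Let_def exercise_prob_eq less_imp_le sim_outcome_cancel)

text \<open>Strictly above \<open>Y_L M\<close> the gain is positive and the series converges; at
  \<open>Y_L M\<close> its ratio would be 1.\<close>

lemma end_prob_exercise_prob_eq:
  assumes "Y_L M < z" "z < Y_F M"
  shows "end_prob (\<lambda>i. exercise_prob M Q \<gamma> i z) m
    = round_prob (\<lambda>i. gain z / loss i z) m
      / (gain z / loss One z + gain z / loss Two z - gain z / loss One z * (gain z / loss Two z))"
  using assms defer_prob_less_1[of z] gain_pos[of z]
  by (simp add: exercise_prob_eq end_prob_eq)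

text \<open>Joins the infinitely repeated game to the closed formulas: both sides reduce to the same
  cancelled fraction, at \<open>Y_L M\<close> as well.\<close>

lemma game_prob_eq_a_lead:
  "game_prob M Q \<gamma> (Exercise, Defer) y = a_lead M Q \<gamma> One y"
  "game_prob M Q \<gamma> (Defer, Exercise) y = a_lead M Q \<gamma> Two y"
  unfolding a_lead_eq game_prob_def
  using lead_outcome_cancel[where i = One] lead_outcome_cancel[where i = Two]
    continuous_on_lead_outcome y
  by (intro limit_at_Y_L_eq;
      simp add: end_prob_exercise_prob_eq round_prob_def algebra_simps)+

lemma game_prob_eq_a_sim: "game_prob M Q \<gamma> (Exercise, Exercise) y = a_sim M Q \<gamma> y"
  unfolding a_sim_eq game_prob_def
  by (intro limit_at_Y_L_eq continuous_on_sim_outcome y)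
    (simp only: end_prob_exercise_prob_eq round_prob_def move_prob.simps fst_conv snd_conv
      sim_outcome_cancel)

lemma E_util_eq_outcomes:
  "E_util M Q \<gamma> i y = a_lead M Q \<gamma> i y * uL M \<gamma> y + a_lead M Q \<gamma> (other i) y * uF M \<gamma> y
     + a_sim M Q \<gamma> y * s_agent M Q \<gamma> i y"
  by (cases i) (simp_all add: game_prob_eq_a_lead game_prob_eq_a_sim)

text \<open>Each agent is indifferent: the opponent's exercise probability makes deferring for ever,
  which yields the follower's utility, as good as any other strategy.\<close>

lemma E_util_eq_uF: "E_util M Q \<gamma> i y = uF M \<gamma> y"
proof -
  let ?l = "uL M \<gamma> y" and ?f = "uF M \<gamma> y" and ?s = "s_agent M Q \<gamma> i y"
  have other: "other (other i) = i"
    by (cases i) simp_all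
  have q: "lead_prob Q i = 1 - lead_prob Q (other i) - sim_prob Q"
    using q_sum by (cases i) simp_all
  have key: "?s - ?f = gain y - loss (other i) y"
    unfolding s_agent_def loss_def gain_def q by (simp add: algebra_simps)
  have "E_util M Q \<gamma> i y
      = ((loss (other i) y - gain y) * ?l + (loss i y - gain y) * ?f + gain y * ?s) / total y"
    unfolding E_util_eq_outcomes a_lead_eq a_sim_eq other by (simp add: add_divide_distrib)
  \<comment> \<open>Writing l as f plus the gain and s_i as f plus a difference collects
    \<open>?f * total y\<close>. By \<open>key\<close> the two remaining terms cancel.\<close>
  also have "(loss (other i) y - gain y) * ?l + (loss i y - gain y) * ?f + gain y * ?s
      = ?f * total y + (loss (other i) y - gain y) * gain y + gain y * (?s - ?f)"
    unfolding total_other[of y i] by (simp add: gain_def algebra_simps)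
  also have "\<dots> = ?f * total y"
    unfolding key by (simp add: algebra_simps)
  finally show ?thesis
    using total_pos[OF y] by simp
qed

lemma indiff_value_eq_F_val: "indiff_value M Q \<gamma> i y = F_val M y"
  using \<gamma>_pos by (simp add: indiff_value_def E_util_eq_uF uF_def inj_utility)

lemma indiff_value_eq_ln:
  "indiff_value M Q \<gamma> i y = - (1 / \<gamma>) * ln (- a_lead M Q \<gamma> i y * uL M \<gamma> y
     - a_lead M Q \<gamma> (other i) y * uF M \<gamma> y - a_sim M Q \<gamma> y * s_agent M Q \<gamma> i y)"
proof -
  have "E_util M Q \<gamma> i y < 0"
    by (simp add: E_util_eq_uF uF_def utility_def)
  then have "indiff_value M Q \<gamma> i y = - (1 / \<gamma>) * ln (- E_util M Q \<gamma> i y)"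
    using \<gamma>_pos by (simp add: indiff_value_def inv_utility)
  then show ?thesis
    unfolding E_util_eq_outcomes by (simp add: algebra_simps)
qed

end

end

text \<open>Without simultaneous assignment the exercise probability of agent two is the constant
  \<open>1 / lead_prob Q Two \<ge> 2\<close> (or \<open>1 / 0 = 0\<close>), so it never equals one.\<close>

lemma (in preemption) sim_prob_pos_of_exercise_prob_eq_1:
  assumes q: "lead_prob Q Two \<le> lead_prob Q One" "0 \<le> sim_prob Q"
      "lead_prob Q One + lead_prob Q Two + sim_prob Q = 1"
    and \<gamma>: "0 < \<gamma>" and Y1: "Y_L M < Y1" "Y1 \<le> Y_F M"
    and one: "exercise_prob M Q \<gamma> Two Y1 = 1"
  shows "0 < sim_prob Q"
proof (rule ccontr)
  assume "\<not> 0 < sim_prob Q"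
  then have qS: "sim_prob Q = 0"
    using q by simp
  have P: "P_formula M Q \<gamma> Two z = 1 / lead_prob Q Two" if "Y_L M < z" "z < Y_F M" for z
    using F_less_L[OF that] \<gamma> by (simp add: P_formula_def qS uL_def uF_def utility_def)
  have "exercise_prob M Q \<gamma> Two Y1 = 1 / lead_prob Q Two"
  proof (cases "Y1 = Y_F M")
    case True
    have "eventually (\<lambda>z. P_formula M Q \<gamma> Two z = 1 / lead_prob Q Two) (at_left (Y_F M))"
      using P Y_L_less_Y_F by (auto simp: eventually_at_left intro: exI[of _ "Y_L M"])
    then have "(P_formula M Q \<gamma> Two \<longlongrightarrow> 1 / lead_prob Q Two) (at_left (Y_F M))"
      by (rule tendsto_eventually)
    then show ?thesis
      using True by (simp add: exercise_prob_def tendsto_Lim)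
  qed (use P Y1 in \<open>auto simp: exercise_prob_def\<close>)
  then show False
    using one q qS by (cases "lead_prob Q Two = 0") auto
qed

theorem proposition9:
  fixes M :: market and Q :: regulator and \<gamma> Y1 y :: real and i :: agent
  assumes "0 < vol M" and "0 < yield_rate M" and "0 < cost M"
    and "0 < demand2 M" and "demand2 M < demand1 M"
    and "lead_prob Q Two \<le> lead_prob Q One" and "0 \<le> lead_prob Q Two" and "0 \<le> sim_prob Q"
    and "lead_prob Q One + lead_prob Q Two + sim_prob Q = 1"
    and "0 < \<gamma>"
    and "Y_L M \<le> Y1" and "Y1 \<le> Y_F M" and "exercise_prob M Q \<gamma> Two Y1 = 1"
    and "Y_L M \<le> y" and "y < Y1"
  shows "indiff_value M Q \<gamma> i y =
           - (1 / \<gamma>) * ln (- a_lead M Q \<gamma> i y * uL M \<gamma> y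
                            - a_lead M Q \<gamma> (other i) y * uF M \<gamma> y
                            - a_sim M Q \<gamma> y * s_agent M Q \<gamma> i y)
         \<and> (0 < sim_prob Q \<longrightarrow>
              indiff_value M Q \<gamma> i y = E_val M y \<and> E_val M y = F_val M y)"
proof -
  interpret preemption M
    by unfold_locales (use assms in auto)
  \<comment> \<open>Both conjuncts are proved in \<open>coordination_game\<close>, which asks for a
    positive \<open>sim_prob Q\<close>. The equation at \<open>Y1\<close> provides it, with
    \<open>Y1\<close> strictly above \<open>Y_L M\<close> because \<open>Y_L M \<le> y\<close> and
    \<open>y < Y1\<close>.\<close>
  have qS: "0 < sim_prob Q"
    using sim_prob_pos_of_exercise_prob_eq_1[of Q \<gamma> Y1] assms by simp
  have "0 \<le> lead_prob Q j" for j
    using assms(6,7) by (cases j) auto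
  then interpret coordination_game M Q \<gamma>
    by unfold_locales (use assms qS in auto)
  have "Y_L M \<le> y" "y < Y_F M"
    using assms by auto
  then show ?thesis
    using indiff_value_eq_ln indiff_value_eq_F_val E_val_eq_F_val by simp
qed

end
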